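(* There exist absolute positive constants $C_5,C_6$ such that for any prime $p\ge3$, any integer $N\ge1$, any integer $K\ge2$ and any real $T$ with $1<T\le C_5p$, \[ \frac1{\#\mathcal V(p,N)^K}\#\Big\{(\beta_1,\dots,\beta_K)\in\mathcal V(p,N)^K:\ \max_{1\le j<k\le K}\Big|\mathfrak d_{p,N}(\beta_j,\beta_k)-\tfrac1{\sqrt2}\Big|\le\tfrac1T\Big\}\ \ge\ 1-\frac{C_6K(K-1)T^2}{p}. \]
   Context: $\omega=\exp(2\pi i/p)$; $\mathcal V(p,N)=\{\sum_{j=1}^{p-1}a_j\omega^j: a_j\in\{-N,N\}\}$. For $\gamma\in\mathbb{Q}(\omega)$, $\mathrm{Tr}(\gamma)=\sum_{\sigma\in\mathrm{Gal}(\mathbb{Q}(\omega)/\mathbb{Q})}\sigma(\gamma)$, $\|\gamma\|=\big(\sum_{j=1}^{p-1}\mathrm{Tr}(\gamma\omega^j)^2\big)^{1/2}$, $\mathfrak d_{p,N}(\alpha,\beta)=\|\beta-\alpha\|/(2Np(p-1)^{1/2})$. *)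

theory Defs
  imports Complex_Main "HOL-Library.FuncSet" "HOL-Algebra.Generated_Fields" "HOL-Algebra.Algebraic_Closure_Type"
begin

definition omega :: "nat \<Rightarrow> complex" where
  "omega p = exp (2 * of_real pi * \<i> / of_nat p)"

definition vertices :: "nat \<Rightarrow> nat \<Rightarrow> complex set" where
  "vertices p N = {(\<Sum>j=1..p-1. of_int (a j) * omega p ^ j) | a :: nat \<Rightarrow> int.
      \<forall>j\<in>{1..p-1}. a j \<in> {- int N, int N}}"

definition cyclotomic_field :: "nat \<Rightarrow> complex ring" where
  "cyclotomic_field p = (ring_of_type_algebra :: complex ring)
     \<lparr>carrier := generate_field ring_of_type_algebra (\<rat> \<union> {omega p})\<rparr>"

(* Each automorphism is represented by exactly one total function on the complex numbers:
   outside of the field it takes the dummy value undefined. *)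
definition galois_group :: "nat \<Rightarrow> (complex \<Rightarrow> complex) set" where
  "galois_group p = {\<sigma> \<in> ring_iso (cyclotomic_field p) (cyclotomic_field p).
      \<sigma> \<in> extensional (carrier (cyclotomic_field p)) \<and> (\<forall>q\<in>\<rat>. \<sigma> q = q)}"

definition cyc_trace :: "nat \<Rightarrow> complex \<Rightarrow> complex" where
  "cyc_trace p \<gamma> = (\<Sum>\<sigma>\<in>galois_group p. \<sigma> \<gamma>)"

(* Traces of elements of the field are rational, so Re only changes the type from complex
   to real. *)
definition trace_norm :: "nat \<Rightarrow> complex \<Rightarrow> real" where
  "trace_norm p \<gamma> = sqrt (\<Sum>j=1..p-1. (Re (cyc_trace p (\<gamma> * omega p ^ j)))\<^sup>2)"

definition ndist :: "nat \<Rightarrow> nat \<Rightarrow> complex \<Rightarrow> complex \<Rightarrow> real" where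
  "ndist p N \<alpha> \<beta> = trace_norm p (\<beta> - \<alpha>) / (2 * real N * real p * sqrt (real p - 1))"

end

theory Submission
  imports Defs
begin

text \<open>
  Since \<open>Tr (\<omega>\<^sup>m)\<close> is \<open>p - 1\<close> if \<open>p\<close> divides \<open>m\<close> and \<open>-1\<close> otherwise, an element
  \<open>\<gamma> = (\<Sum>j=1..p-1. c\<^sub>j \<omega>\<^sup>j)\<close> has \<open>Tr (\<gamma> \<omega>\<^sup>k) = p c\<^sub>p\<^sub>-\<^sub>k - S\<close> with \<open>S = (\<Sum>j. c\<^sub>j)\<close>, and so
  \<open>\<parallel>\<gamma>\<parallel>\<^sup>2 = p\<^sup>2 (\<Sum>j. c\<^sub>j\<^sup>2) - (p + 1) S\<^sup>2\<close>. The same formula shows that the \<open>\<omega>\<^sup>j\<close> are independent,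
  so that vertices correspond to sign vectors \<open>a, b\<close>, and the squared distance of two of them
  differs from \<open>1/2\<close> by
  \<open>-(\<Sum>j. a\<^sub>j b\<^sub>j) / (2 (p - 1)) - (p + 1) (\<Sum>j. b\<^sub>j - a\<^sub>j)\<^sup>2 / (4 p\<^sup>2 (p - 1))\<close>.
  The mean square of this deviation is at most \<open>5 / p\<close> by the second and fourth moments of sums of
  independent signs. Chebyshev's inequality bounds the proportion of bad pairs by
  \<open>10 T\<^sup>2 / p\<close>, and a union bound over the pairs of the tuple finishes the proof.
\<close>

subsection \<open>Irreducibility of the cyclotomic polynomial\<close>

text \<open>Rational polynomials act as names for field elements: an element of Q(omega) is the
  value of such a polynomial at omega, and its conjugates are the values at other roots of
  unity.\<close>

abbreviation "rat_eval f z \<equiv> poly (map_poly of_rat f) (z :: complex)"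

lemma map_poly_of_rat_add: "map_poly of_rat (f + g) = map_poly of_rat f + (map_poly of_rat g :: complex poly)"
  by (rule poly_eqI) (simp add: coeff_map_poly of_rat_add)

lemma map_poly_of_rat_mult: "map_poly of_rat (f * g) = map_poly of_rat f * (map_poly of_rat g :: complex poly)"
  by (rule poly_eqI) (simp add: coeff_map_poly coeff_mult of_rat_sum of_rat_mult)

lemma map_poly_of_rat_minus: "map_poly of_rat (- f) = - (map_poly of_rat f :: complex poly)"
  by (rule poly_eqI) (simp add: coeff_map_poly of_rat_minus)

lemma map_poly_of_int_mult:
  "map_poly of_int (f * g) = map_poly of_int f * (map_poly of_int g :: 'a :: comm_ring_1 poly)"
  by (rule poly_eqI) (simp add: coeff_map_poly coeff_mult)

lemma rat_eval_pcompose: "rat_eval (pcompose f g) z = rat_eval f (rat_eval g z)"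
  by (induction f) (simp_all add: pcompose_pCons map_poly_pCons map_poly_of_rat_add map_poly_of_rat_mult)

lemma rat_eval_power: "rat_eval (f ^ k) z = rat_eval f z ^ k"
  by (induction k) (simp_all add: map_poly_of_rat_mult)

lemma rat_eval_sum: "rat_eval (sum f A) z = (\<Sum>i\<in>A. rat_eval (f i) z)"
  by (induction A rule: infinite_finite_induct) (simp_all add: map_poly_of_rat_add)

section \<open>Gauss's lemma and Eisenstein's criterion\<close>

lemma clear_denominators:
  fixes f :: "rat poly"
  obtains D :: int and F :: "int poly" where "D \<noteq> 0" "smult (of_int D) f = map_poly of_int F"
proof -
  have "\<exists>(D::int) F. D \<noteq> 0 \<and> smult (of_int D) f = map_poly of_int F"
  proof (induction f)
    case 0
    show ?case by (rule exI[of _ 1], rule exI[of _ 0]) simp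
  next
    case (pCons a f)
    then obtain D :: int and F where DF: "D \<noteq> 0" "smult (of_int D) f = map_poly of_int F"
      by blast
    obtain n d where nd: "quotient_of a = (n, d)" by fastforce
    have d: "d \<noteq> 0" "a = of_int n / of_int d"
      using nd quotient_of_denom_pos[OF nd] quotient_of_div[OF nd] by auto
    have "smult (of_int d) (map_poly of_int F) = (map_poly of_int (smult d F) :: rat poly)"
      by (rule poly_eqI) (simp add: coeff_map_poly)
    then have "smult (of_int d) (smult (of_int D) f) = map_poly of_int (smult d F)"
      using DF by metis
    then have "smult (of_int (d * D)) (pCons a f) = map_poly of_int (pCons (n * D) (smult d F))"
      using d by (simp add: map_poly_pCons)
    then show ?case using DF(1) d(1) by (metis mult_eq_0_iff)
  qed
  then show ?thesis using that by blast
qed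

text \<open>A form of Gauss's lemma. After clearing denominators \<open>P\<close> divides
  \<open>F * G\<close> over the integers, hence one of the two factors. That factor then has the
  full degree of \<open>P\<close>, and the other is a nonzero constant. Starting from primality
  instead of irreducibility avoids any discussion of contents.\<close>

lemma irreducible_map_poly_of_int:
  fixes P :: "int poly"
  assumes "prime_elem P" "Polynomial.degree P > 0"
  shows "Factorial_Ring.irreducible (map_poly of_int P :: rat poly)"
proof (rule Factorial_Ring.irreducibleI)
  have deg: "Polynomial.degree (map_poly of_int F :: rat poly) = Polynomial.degree F" for F
    by (rule degree_map_poly) simp
  show "(map_poly of_int P :: rat poly) \<noteq> 0" "\<not> is_unit (map_poly of_int P :: rat poly)"
    using assms(2) deg[of P] by (auto simp: is_unit_poly_iff)
  fix f g :: "rat poly"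
  assume fg: "map_poly of_int P = f * g"
  obtain D F where F: "D \<noteq> 0" "smult (of_int D) f = map_poly of_int F"
    by (rule clear_denominators)
  obtain E G where G: "E \<noteq> 0" "smult (of_int E) g = map_poly of_int G"
    by (rule clear_denominators)
  have nz: "f \<noteq> 0" "g \<noteq> 0" using fg assms(2) deg[of P] by auto
  have dF: "Polynomial.degree F = Polynomial.degree f" using arg_cong[OF F(2), of Polynomial.degree] F(1) by (simp add: deg)
  have dG: "Polynomial.degree G = Polynomial.degree g" using arg_cong[OF G(2), of Polynomial.degree] G(1) by (simp add: deg)
  have "map_poly of_int (F * G) = smult (of_int (D * E)) (map_poly of_int P :: rat poly)"
    by (simp add: map_poly_of_int_mult fg mult.commute flip: F(2) G(2))
  also have "\<dots> = map_poly of_int (smult (D * E) P)"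
    by (rule poly_eqI) (simp add: coeff_map_poly)
  finally have eq: "map_poly of_int (F * G) = (map_poly of_int (smult (D * E) P) :: rat poly)" .
  have "F * G = smult (D * E) P"
  proof (rule poly_eqI)
    fix n
    have "(of_int (Polynomial.coeff (F * G) n) :: rat) = of_int (Polynomial.coeff (smult (D * E) P) n)"
      using arg_cong[OF eq, of "\<lambda>f. Polynomial.coeff f n"]
      unfolding coeff_map_poly[of rat_of_int, OF of_int_0] .
    then show "Polynomial.coeff (F * G) n = Polynomial.coeff (smult (D * E) P) n"
      by (rule of_int_eq_iff[THEN iffD1])
  qed
  then have "P dvd F * G" by (metis dvd_smult dvd_refl)
  then consider "P dvd F" | "P dvd G" using assms(1) prime_elem_dvd_mult_iff by blast
  moreover have "F \<noteq> 0" "G \<noteq> 0"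
    using F G nz by auto
  ultimately have "Polynomial.degree P \<le> Polynomial.degree f \<or> Polynomial.degree P \<le> Polynomial.degree g"
    using dvd_imp_degree_le dF dG by metis
  moreover have "Polynomial.degree P = Polynomial.degree f + Polynomial.degree g"
    using fg nz deg[of P] by (simp add: degree_mult_eq)
  ultimately show "is_unit f \<or> is_unit g"
    using nz by (auto simp: is_unit_iff_degree)
qed

text \<open>Take the least \<open>r\<close> for which \<open>q\<close> does not divide coefficient
  \<open>r\<close> of \<open>h\<close>. Modulo \<open>q\<close>, coefficient \<open>r\<close> of
  \<open>g * h\<close> is the product of coefficient 0 of \<open>g\<close> and coefficient
  \<open>r\<close> of \<open>h\<close>, so it is nonzero. If \<open>g\<close> were not constant,
  \<open>r\<close> would lie below the degree of \<open>g * h\<close>, where \<open>q\<close>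
  divides every coefficient.\<close>

lemma eisenstein_factor:
  fixes g h :: "int poly"
  assumes q: "Factorial_Ring.prime q"
    and dvd: "\<And>i. i < Polynomial.degree (g * h) \<Longrightarrow> q dvd Polynomial.coeff (g * h) i"
    and g0: "\<not> q dvd Polynomial.coeff g 0" and lead: "\<not> q dvd Polynomial.lead_coeff h"
  shows "Polynomial.degree g = 0"
proof (rule ccontr)
  assume g: "Polynomial.degree g \<noteq> 0"
  define r where "r = (LEAST r. \<not> q dvd Polynomial.coeff h r)"
  have r: "\<not> q dvd Polynomial.coeff h r" unfolding r_def by (rule LeastI) (rule lead)
  have less: "q dvd Polynomial.coeff h i" if "i < r" for i
    using not_less_Least that unfolding r_def by blast
  have "r \<le> Polynomial.degree h" unfolding r_def by (rule Least_le) (rule lead)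
  moreover have "g \<noteq> 0" "h \<noteq> 0" using g lead by auto
  ultimately have "r < Polynomial.degree (g * h)" using g by (simp add: degree_mult_eq)
  then have "q dvd Polynomial.coeff (g * h) r" by (rule dvd)
  moreover have "Polynomial.coeff (g * h) r = Polynomial.coeff g 0 * Polynomial.coeff h r
      + (\<Sum>i=1..r. Polynomial.coeff g i * Polynomial.coeff h (r - i))"
    unfolding coeff_mult by (simp add: sum.atMost_shift atLeast0AtMost sum.atLeast1_atMost_eq lessThan_atLeast0)
  moreover have "q dvd (\<Sum>i=1..r. Polynomial.coeff g i * Polynomial.coeff h (r - i))"
    by (rule dvd_sum) (auto intro!: dvd_mult less)
  ultimately have "q dvd Polynomial.coeff g 0 * Polynomial.coeff h r"
    by (simp add: dvd_add_left_iff)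
  then show False using q g0 r by (simp add: prime_dvd_mult_iff)
qed

text \<open>As \<open>q\<close>^2 does not divide the constant term of \<open>f\<close>, the prime
  \<open>q\<close> misses the constant term of one factor, which must then be constant by the
  previous lemma. Since \<open>f\<close> is monic, both leading coefficients are units, so the
  constant factor is a unit.\<close>

theorem eisenstein:
  fixes f :: "int poly"
  assumes q: "Factorial_Ring.prime q" and deg: "Polynomial.degree f > 0" and lead: "Polynomial.lead_coeff f = 1"
    and dvd: "\<And>i. i < Polynomial.degree f \<Longrightarrow> q dvd Polynomial.coeff f i"
    and sq: "\<not> q\<^sup>2 dvd Polynomial.coeff f 0"
  shows "Factorial_Ring.irreducible f"
proof (rule Factorial_Ring.irreducibleI)
  show "f \<noteq> 0" "\<not> is_unit f" using deg by (auto simp: is_unit_poly_iff)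
  fix g h assume f: "f = g * h"
  have lc: "Polynomial.lead_coeff g * Polynomial.lead_coeff h = 1"
    using lead f by (simp add: lead_coeff_mult)
  then have units: "is_unit (Polynomial.lead_coeff g)" "is_unit (Polynomial.lead_coeff h)"
    by (metis dvd_triv_left, metis dvd_triv_right)
  then have nd: "\<not> q dvd Polynomial.lead_coeff g" "\<not> q dvd Polynomial.lead_coeff h"
    using q not_prime_unit dvd_unit_imp_unit by blast+
  have unit: "is_unit k" if "Polynomial.degree k = 0" "is_unit (Polynomial.lead_coeff k)" for k :: "int poly"
    using that by (metis degree_eq_zeroE lead_coeff_pCons(2) is_unit_const_poly_iff)
  have "Polynomial.coeff f 0 = Polynomial.coeff g 0 * Polynomial.coeff h 0"
    by (simp add: f coeff_mult)
  then have "\<not> (q dvd Polynomial.coeff g 0 \<and> q dvd Polynomial.coeff h 0)"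
    using sq by (auto simp: power2_eq_square intro: mult_dvd_mono)
  then consider "\<not> q dvd Polynomial.coeff g 0" | "\<not> q dvd Polynomial.coeff h 0" by blast
  then show "is_unit g \<or> is_unit h"
  proof cases
    case 1
    have "Polynomial.degree g = 0"
      by (rule eisenstein_factor[of q g h]) (use q dvd f 1 nd in auto)
    then show ?thesis using unit units by blast
  next
    case 2
    have "Polynomial.degree h = 0"
      by (rule eisenstein_factor[of q h g]) (use q dvd f 2 nd in \<open>auto simp: mult.commute\<close>)
    then show ?thesis using unit units by blast
  qed
qed

text \<open>The cyclotomic polynomial is expanded at \<open>1\<close>, where Eisenstein's criterion applies.\<close>

definition shifted_cyclotomic :: "nat \<Rightarrow> int poly" where
  "shifted_cyclotomic p = (\<Sum>i<p. Polynomial.monom (int (p choose Suc i)) i)"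

lemma coeff_shifted_cyclotomic: "Polynomial.coeff (shifted_cyclotomic p) i = int (p choose Suc i)"
  by (simp add: shifted_cyclotomic_def coeff_sum)

lemma degree_shifted_cyclotomic:
  assumes "p > 0" shows "Polynomial.degree (shifted_cyclotomic p) = p - 1"
proof (rule antisym)
  show "Polynomial.degree (shifted_cyclotomic p) \<le> p - 1"
    by (rule degree_le) (auto simp: coeff_shifted_cyclotomic)
  show "p - 1 \<le> Polynomial.degree (shifted_cyclotomic p)"
    by (rule le_degree) (use assms in \<open>simp add: coeff_shifted_cyclotomic\<close>)
qed

text \<open>Binomial expansion of z^p = ((z - 1) + 1)^p. It shows that the polynomial is (z^p - 1) /
  (z - 1) written in the variable z - 1.\<close>

lemma poly_shifted_cyclotomic:
  fixes z :: "'a :: comm_ring_1"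
  shows "(z - 1) * poly (map_poly of_int (shifted_cyclotomic p)) (z - 1) = z ^ p - 1"
proof -
  have eq: "map_poly of_int (shifted_cyclotomic p) = (\<Sum>i<p. Polynomial.monom (of_nat (p choose Suc i) :: 'a) i)"
    by (rule poly_eqI) (auto simp: coeff_map_poly coeff_shifted_cyclotomic coeff_sum binomial_eq_0)
  have "z ^ p = ((z - 1) + 1) ^ p" by simp
  also have "\<dots> = (\<Sum>i\<le>p. of_nat (p choose i) * (z - 1) ^ i)"
    by (subst binomial_ring) simp
  also have "\<dots> = 1 + (z - 1) * (\<Sum>i<p. of_nat (p choose Suc i) * (z - 1) ^ i)"
    by (simp add: sum.atMost_shift sum_distrib_left mult_ac)
  finally show ?thesis
    by (simp add: eq poly_sum poly_monom)
qed

lemma irreducible_shifted_cyclotomic: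
  assumes "Factorial_Ring.prime p"
  shows "Factorial_Ring.irreducible (shifted_cyclotomic p)"
proof (rule eisenstein[where q = "int p"])
  have p: "p \<ge> 2" using assms prime_ge_2_nat by blast
  show "Factorial_Ring.prime (int p)" using assms by simp
  show "Polynomial.degree (shifted_cyclotomic p) > 0" "Polynomial.lead_coeff (shifted_cyclotomic p) = 1"
    using p by (simp_all add: degree_shifted_cyclotomic coeff_shifted_cyclotomic)
  show "int p dvd Polynomial.coeff (shifted_cyclotomic p) i" if "i < Polynomial.degree (shifted_cyclotomic p)" for i
    using that p assms by (auto simp: degree_shifted_cyclotomic coeff_shifted_cyclotomic intro!: dvd_choose_prime)
  show "\<not> (int p)\<^sup>2 dvd Polynomial.coeff (shifted_cyclotomic p) 0"
  proof
    assume "(int p)\<^sup>2 dvd Polynomial.coeff (shifted_cyclotomic p) 0"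
    then have "p ^ 2 dvd p" by (simp add: coeff_shifted_cyclotomic flip: of_nat_power)
    then have "p ^ 2 \<le> p" using p by (intro dvd_imp_le) auto
    then show False using p by (simp add: power2_eq_square)
  qed
qed

lemma rat_eval_shifted_cyclotomic:
  assumes "z ^ p = 1" "z \<noteq> 1"
  shows "rat_eval (map_poly of_int (shifted_cyclotomic p)) (z - 1) = 0"
  using poly_shifted_cyclotomic[of z p] assms by (simp add: map_poly_map_poly o_def)

text \<open>An irreducible polynomial divides a given one or is coprime to it. In the coprime case a
  Bezout identity, evaluated at \<open>z - 1\<close> where the cyclotomic part vanishes, exhibits an
  inverse of the value of \<open>f\<close> at \<open>z\<close>. Inverses and conjugates both follow
  from this dichotomy.\<close>

lemma shifted_cyclotomic_cases:
  assumes p: "Factorial_Ring.prime p" and z: "z ^ p = 1" "z \<noteq> 1"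
  obtains "map_poly of_int (shifted_cyclotomic p) dvd pcompose f [:1, 1:]"
  | u where "rat_eval f z * rat_eval u z = 1"
proof -
  define P :: "rat poly" where "P = map_poly of_int (shifted_cyclotomic p)"
  define g where "g = pcompose f [:1, 1:]"
  have g: "rat_eval g (z - 1) = rat_eval f z"
    unfolding g_def rat_eval_pcompose by (simp add: map_poly_pCons)
  have "p > 1" using p prime_gt_1_nat by blast
  then have "Factorial_Ring.irreducible P"
    unfolding P_def
    by (intro irreducible_map_poly_of_int irreducible_imp_prime_elem irreducible_shifted_cyclotomic p)
       (simp add: degree_shifted_cyclotomic)
  then have "prime_elem P" by (rule irreducible_imp_prime_elem)
  then consider "P dvd g" | "Rings.coprime P g" using prime_elem_imp_coprime by blast
  then show thesis
  proof cases
    case 1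
    then show ?thesis using that(1) by (simp add: P_def g_def)
  next
    case 2
    obtain u v where uv: "u * P + v * g = 1"
      using bezout_coefficients_fst_snd[of P g] 2 by (metis coprime_imp_gcd_eq_1)
    have "rat_eval (u * P + v * g) (z - 1) = rat_eval v (z - 1) * rat_eval f z"
      using rat_eval_shifted_cyclotomic[OF z] g
      by (simp add: map_poly_of_rat_add map_poly_of_rat_mult P_def)
    \<comment> \<open>Substituting x - 1 into \<open>v\<close> turns a value at \<open>z - 1\<close>
      into a value at \<open>z\<close>.\<close>
    then have "rat_eval f z * rat_eval (pcompose v [:-1, 1:]) z = 1"
      unfolding uv rat_eval_pcompose by (simp add: map_poly_pCons mult.commute)
    then show ?thesis by (rule that(2))
  qed
qed

lemma rat_eval_inverse:
  assumes "Factorial_Ring.prime p" "z ^ p = 1" "z \<noteq> 1" "rat_eval f z \<noteq> 0"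
  obtains u where "rat_eval f z * rat_eval u z = 1"
proof (rule shifted_cyclotomic_cases[OF assms(1-3), of f])
  assume "map_poly of_int (shifted_cyclotomic p) dvd pcompose f [:1, 1:]"
  then obtain h where "pcompose f [:1, 1:] = map_poly of_int (shifted_cyclotomic p) * h" ..
  then have "rat_eval (pcompose f [:1, 1:]) (z - 1) = 0"
    using rat_eval_shifted_cyclotomic[OF assms(2,3)] by (simp add: map_poly_of_rat_mult)
  then show ?thesis using assms(4) by (simp add: rat_eval_pcompose map_poly_pCons)
qed (rule that)

text \<open>A zero value rules out the invertible case. The remaining divisibility does not mention
  \<open>z\<close>, so it forces a zero at every nontrivial p-th root of unity.\<close>

lemma rat_eval_conjugate:
  assumes "Factorial_Ring.prime p" "z ^ p = 1" "z \<noteq> 1" "w ^ p = 1" "w \<noteq> 1" "rat_eval f z = 0"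
  shows "rat_eval f w = 0"
proof (rule shifted_cyclotomic_cases[OF assms(1-3), of f])
  assume "map_poly of_int (shifted_cyclotomic p) dvd pcompose f [:1, 1:]"
  then obtain h where "pcompose f [:1, 1:] = map_poly of_int (shifted_cyclotomic p) * h" ..
  then have "rat_eval (pcompose f [:1, 1:]) (w - 1) = 0"
    using rat_eval_shifted_cyclotomic[OF assms(4,5)] by (simp add: map_poly_of_rat_mult)
  then show ?thesis by (simp add: rat_eval_pcompose map_poly_pCons)
qed (use assms(6) in simp)

lemma rat_eval_conjugate_eq:
  assumes "Factorial_Ring.prime p" "z ^ p = 1" "z \<noteq> 1" "w ^ p = 1" "w \<noteq> 1" "rat_eval f z = rat_eval g z"
  shows "rat_eval f w = rat_eval g w"
proof -
  have *: "rat_eval (f + - g) x = rat_eval f x - rat_eval g x" for x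
    by (simp only: map_poly_of_rat_add map_poly_of_rat_minus) simp
  show ?thesis
    using rat_eval_conjugate[OF assms(1-5), of "f + - g"] assms(6) unfolding * by simp
qed

section \<open>Powers of the root of unity\<close>

lemma omega_power: "omega p ^ k = cis (2 * pi * real k / real p)"
proof -
  have "omega p = cis (2 * pi / real p)"
    by (simp add: omega_def cis_conv_exp mult_ac)
  then show ?thesis by (simp add: DeMoivre mult_ac)
qed

lemma omega_power_p [simp]: "p > 0 \<Longrightarrow> omega p ^ p = 1"
  by (simp add: omega_power)

lemma omega_power_eq_1_iff:
  assumes "p > 0" shows "omega p ^ k = 1 \<longleftrightarrow> p dvd k"
proof -
  have "omega p ^ k = omega p ^ (p * (k div p) + k mod p)" by simp
  also have "\<dots> = omega p ^ (k mod p)"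
    unfolding power_add power_mult using assms by simp
  finally have k: "omega p ^ k = omega p ^ (k mod p)" .
  have "omega p ^ (k mod p) = omega p ^ 0 \<longleftrightarrow> k mod p = 0"
    using bij_betw_roots_unity[OF assms] assms
    unfolding omega_power bij_betw_def by (subst inj_on_eq_iff) auto
  then show ?thesis using k by (simp add: mod_eq_0_iff_dvd)
qed

lemma unity_root_omega_power:
  assumes "p > 0" "z ^ p = 1" obtains k where "k < p" "z = omega p ^ k"
  using bij_betw_roots_unity[OF assms(1)] assms(2) that
  unfolding bij_betw_def omega_power by blast

subsection \<open>The Galois group and the trace\<close>

lemma complex_ring_simps [simp]:
  "carrier (ring_of_type_algebra :: complex ring) = UNIV"
  "monoid.mult (ring_of_type_algebra :: complex ring) = (*)"
  "monoid.one (ring_of_type_algebra :: complex ring) = 1"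
  "ring.zero (ring_of_type_algebra :: complex ring) = 0"
  "ring.add (ring_of_type_algebra :: complex ring) = (+)"
  by (auto simp: ring_of_type_algebra_def)

lemma complex_ring_a_inv [simp]: "a_inv (ring_of_type_algebra :: complex ring) x = - x"
proof -
  interpret Ring.field "ring_of_type_algebra :: complex ring" by (rule field_from_type_algebra)
  show ?thesis by (rule minus_equality) simp_all
qed

lemma complex_ring_m_inv: "x \<noteq> 0 \<Longrightarrow> m_inv (ring_of_type_algebra :: complex ring) x = inverse x"
proof -
  interpret Ring.field "ring_of_type_algebra :: complex ring" by (rule field_from_type_algebra)
  assume "x \<noteq> 0" then show ?thesis by (intro comm_inv_char) simp_all
qed

lemma cyclotomic_field_simps [simp]:
  "monoid.mult (cyclotomic_field p) = (*)" "monoid.one (cyclotomic_field p) = 1" "ring.add (cyclotomic_field p) = (+)"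
  by (simp_all add: cyclotomic_field_def)

text \<open>Polynomial values at omega are evidently closed under sums and products; closure under
  inverses is where the irreducibility enters, through \<open>rat_eval_inverse\<close>.\<close>

lemma carrier_cyclotomic_field:
  assumes "Factorial_Ring.prime p"
  shows "carrier (cyclotomic_field p) = range (\<lambda>f. rat_eval f (omega p))"
proof
  interpret K: Ring.field "ring_of_type_algebra :: complex ring" by (rule field_from_type_algebra)
  let ?G = "generate_field (ring_of_type_algebra :: complex ring) (\<rat> \<union> {omega p})"
  have p: "p > 1" using assms prime_gt_1_nat by blast
  have "x \<in> range (\<lambda>f. rat_eval f (omega p))" if "x \<in> ?G" for x
    using that
  proof induction
    case one
    show ?case by (rule range_eqI[of _ _ 1]) simp
  next
    case (incl h)
    then consider r where "h = of_rat r" | "h = omega p" by (auto simp: Rats_def)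
    then show ?case
    proof cases
      case 1
      then show ?thesis by (intro range_eqI[of _ _ "[:r:]"]) (simp add: map_poly_pCons)
    next
      case 2
      then show ?thesis by (intro range_eqI[of _ _ "[:0, 1:]"]) (simp add: map_poly_pCons)
    qed
  next
    case (a_inv h)
    then obtain f where "h = rat_eval f (omega p)" by blast
    then show ?case
      by (intro range_eqI[of _ _ "- f"]) (simp add: map_poly_of_rat_minus)
  next
    case (m_inv h)
    then obtain f where f: "h = rat_eval f (omega p)" "h \<noteq> 0" by auto
    obtain u where "h * rat_eval u (omega p) = 1"
      using rat_eval_inverse[OF assms, of "omega p" f] f p omega_power_eq_1_iff[of p 1] by auto
    then show ?case
      by (intro range_eqI[of _ _ u]) (use f(2) in \<open>simp add: complex_ring_m_inv field_simps\<close>)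
  next
    case (eng_add x y)
    then obtain f g where "x = rat_eval f (omega p)" "y = rat_eval g (omega p)" by blast
    then show ?case by (intro range_eqI[of _ _ "f + g"]) (simp add: map_poly_of_rat_add)
  next
    case (eng_mult x y)
    then obtain f g where "x = rat_eval f (omega p)" "y = rat_eval g (omega p)" by blast
    then show ?case by (intro range_eqI[of _ _ "f * g"]) (simp add: map_poly_of_rat_mult)
  qed
  then show "carrier (cyclotomic_field p) \<subseteq> range (\<lambda>f. rat_eval f (omega p))"
    by (auto simp: cyclotomic_field_def)
  have "rat_eval f (omega p) \<in> ?G" for f
  proof (induction f)
    case 0
    show ?case using K.zero_in_generate by simp
  next
    case (pCons a f)
    have "of_rat a \<in> ?G" "omega p \<in> ?G" by (auto intro: generate_field.incl)
    then show ?case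
      using generate_field.eng_add[OF _ generate_field.eng_mult[OF _ pCons(2)]]
      by (simp add: map_poly_pCons)
  qed
  then show "range (\<lambda>f. rat_eval f (omega p)) \<subseteq> carrier (cyclotomic_field p)"
    by (auto simp: cyclotomic_field_def)
qed

text \<open>The automorphism sending omega to omega^a. The chosen representing polynomial does not
  affect the value when \<open>a\<close> lies in \<open>{1..p-1}\<close>, and the restricted
  abstraction gives the extensional form that \<open>galois_group\<close> demands.\<close>

definition cyclotomic_aut :: "nat \<Rightarrow> nat \<Rightarrow> complex \<Rightarrow> complex" where
  "cyclotomic_aut p a = (\<lambda>x\<in>carrier (cyclotomic_field p).
     rat_eval (SOME f. rat_eval f (omega p) = x) (omega p ^ a))"

context
  fixes p :: nat
  assumes p: "Factorial_Ring.prime p"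
begin

lemma p_bounds: "p > 0" "p > 1"
  using p prime_gt_1_nat prime_gt_0_nat by auto

lemma omega_power_root:
  assumes "a \<in> {1..p-1}" shows "(omega p ^ a) ^ p = 1" "omega p ^ a \<noteq> 1"
proof -
  show "(omega p ^ a) ^ p = 1" using p_bounds by (metis omega_power_p power_mult mult.commute power_one)
  have "\<not> p dvd a" using assms by (auto dest: dvd_imp_le)
  then show "omega p ^ a \<noteq> 1" using p_bounds by (simp add: omega_power_eq_1_iff)
qed

text \<open>The chosen polynomial agrees with \<open>f\<close> at omega, hence also at the conjugate
  omega^a.\<close>

lemma cyclotomic_aut_rat_eval:
  assumes "a \<in> {1..p-1}"
  shows "cyclotomic_aut p a (rat_eval f (omega p)) = rat_eval f (omega p ^ a)"
proof -
  define g where "g = (SOME g. rat_eval g (omega p) = rat_eval f (omega p))"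
  have "rat_eval g (omega p) = rat_eval f (omega p)"
    unfolding g_def by (rule someI) (rule refl)
  then have "rat_eval g (omega p ^ a) = rat_eval f (omega p ^ a)"
    using omega_power_root[of 1] p_bounds
    by (intro rat_eval_conjugate_eq[OF p _ _ omega_power_root[OF assms]]) auto
  then show ?thesis
    unfolding cyclotomic_aut_def carrier_cyclotomic_field[OF p] g_def by simp
qed

lemma cyclotomic_aut_compose:
  assumes "a \<in> {1..p-1}" "b \<in> {1..p-1}" "a * b mod p = 1"
  shows "cyclotomic_aut p a (cyclotomic_aut p b (rat_eval f (omega p))) = rat_eval f (omega p)"
proof -
  have "omega p ^ (a * b) = omega p"
  proof -
    have "a * b = 1 + p * (a * b div p)" 
      using assms(3) mod_mult_div_eq[of "a * b" p] by simp
    then have "omega p ^ (a * b) = omega p ^ (1 + p * (a * b div p))" by simp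
    also have "\<dots> = omega p" using p_bounds by (simp add: power_mult)
    finally show ?thesis .
  qed
  then have "rat_eval f (omega p) = rat_eval (pcompose f ([:0, 1:] ^ b)) (omega p ^ a)"
    by (simp add: rat_eval_pcompose rat_eval_power map_poly_pCons power_mult)
  also have "\<dots> = cyclotomic_aut p a (rat_eval (pcompose f ([:0, 1:] ^ b)) (omega p))"
    by (rule cyclotomic_aut_rat_eval[OF assms(1), symmetric])
  also have "rat_eval (pcompose f ([:0, 1:] ^ b)) (omega p) = cyclotomic_aut p b (rat_eval f (omega p))"
    by (simp add: cyclotomic_aut_rat_eval[OF assms(2)] rat_eval_pcompose rat_eval_power map_poly_pCons)
  finally show ?thesis by (rule sym)
qed

text \<open>Evaluation at omega^a respects sums and products and fixes constants. Bijectivity comes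
  from the explicit inverse \<open>cyclotomic_aut p b\<close>, where \<open>b\<close> is the inverse
  of \<open>a\<close> modulo \<open>p\<close>.\<close>

lemma cyclotomic_aut_in_galois_group:
  assumes a: "a \<in> {1..p-1}"
  shows "cyclotomic_aut p a \<in> galois_group p"
proof -
  let ?F = "cyclotomic_field p"
  note car = carrier_cyclotomic_field[OF p]
  have "\<not> p dvd a" using a by (auto dest: dvd_imp_le)
  then have "Rings.coprime a p" using p prime_imp_coprime coprime_commute by blast
  then obtain b0 y where "a * b0 = p * y + 1" using a bezout_nat[of a p] by auto
  then have b0: "a * b0 mod p = 1" using p_bounds mod_mult_self4[of p y 1] by simp
  \<comment> \<open>Bezout gives some inverse of \<open>a\<close>; reducing it brings it into the
    index range \<open>{1..p-1}\<close>.\<close>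
  define b where "b = b0 mod p"
  have ab: "a * b mod p = 1" using b0 by (simp add: b_def mod_mult_right_eq)
  have "b \<noteq> 0" using ab by (intro notI) simp
  moreover have "b < p" unfolding b_def using p_bounds by simp
  ultimately have b: "b \<in> {1..p-1}" by auto
  have closed: "cyclotomic_aut p c x \<in> carrier ?F" if cx: "c \<in> {1..p-1}" "x \<in> carrier ?F" for c x
  proof -
    obtain f where f: "x = rat_eval f (omega p)" using cx(2) car by auto
    have "cyclotomic_aut p c x = rat_eval (pcompose f ([:0, 1:] ^ c)) (omega p)"
      using cx(1) by (simp only: f cyclotomic_aut_rat_eval) (simp add: rat_eval_pcompose rat_eval_power map_poly_pCons)
    then show ?thesis using car by auto
  qed
  have "bij_betw (cyclotomic_aut p a) (carrier ?F) (carrier ?F)"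
    by (rule bij_betwI[where g = "cyclotomic_aut p b"])
       (use a b ab closed in \<open>auto simp: car cyclotomic_aut_compose mult.commute\<close>)
  moreover have "cyclotomic_aut p a \<in> ring_hom ?F ?F"
  proof (rule ring_hom_memI)
    show "cyclotomic_aut p a \<one>\<^bsub>?F\<^esub> = \<one>\<^bsub>?F\<^esub>"
      using cyclotomic_aut_rat_eval[OF a, of 1] by simp
    fix x assume x: "x \<in> carrier ?F"
    then show "cyclotomic_aut p a x \<in> carrier ?F" using closed a by blast
    fix y assume y: "y \<in> carrier ?F"
    obtain f g where fg: "x = rat_eval f (omega p)" "y = rat_eval g (omega p)"
      using x y car by auto
    show "cyclotomic_aut p a (x \<otimes>\<^bsub>?F\<^esub> y) = cyclotomic_aut p a x \<otimes>\<^bsub>?F\<^esub> cyclotomic_aut p a y"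
      using cyclotomic_aut_rat_eval[OF a, of "f * g"] 
      by (simp add: fg cyclotomic_aut_rat_eval[OF a] map_poly_of_rat_mult)
    show "cyclotomic_aut p a (x \<oplus>\<^bsub>?F\<^esub> y) = cyclotomic_aut p a x \<oplus>\<^bsub>?F\<^esub> cyclotomic_aut p a y"
      using cyclotomic_aut_rat_eval[OF a, of "f + g"] 
      by (simp add: fg cyclotomic_aut_rat_eval[OF a] map_poly_of_rat_add)
  qed
  moreover have "cyclotomic_aut p a q = q" if "q \<in> \<rat>" for q
  proof -
    obtain r where "q = of_rat r" using \<open>q \<in> \<rat>\<close> by (auto simp: Rats_def)
    then show ?thesis using cyclotomic_aut_rat_eval[OF a, of "[:r:]"] by (simp add: map_poly_pCons)
  qed
  ultimately show ?thesis
    by (auto simp: galois_group_def ring_iso_def cyclotomic_aut_def)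
qed

text \<open>An automorphism fixing the rationals commutes with evaluating rational polynomials, so
  it is determined by the image of omega. That image is a p-th root of unity other than 1.\<close>

lemma galois_group_eq: "galois_group p = cyclotomic_aut p ` {1..p-1}"
proof
  show "cyclotomic_aut p ` {1..p-1} \<subseteq> galois_group p"
    using cyclotomic_aut_in_galois_group by blast
  show "galois_group p \<subseteq> cyclotomic_aut p ` {1..p-1}"
  proof
    fix s assume "s \<in> galois_group p"
    then have s: "s \<in> ring_hom (cyclotomic_field p) (cyclotomic_field p)"
      "inj_on s (carrier (cyclotomic_field p))"
      "s \<in> extensional (carrier (cyclotomic_field p))" "\<And>q. q \<in> \<rat> \<Longrightarrow> s q = q"
      by (auto simp: galois_group_def ring_iso_def bij_betw_def)
    note car = carrier_cyclotomic_field[OF p]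
    define K where "K = carrier (cyclotomic_field p)"
    have K: "rat_eval f (omega p) \<in> K" for f by (auto simp: K_def car)
    have om: "omega p \<in> K" using K[of "[:0, 1:]"] by (simp add: map_poly_pCons)
    have rat: "of_rat r \<in> K" for r using K[of "[:r:]"] by (simp add: map_poly_pCons)
    have add: "s (x + y) = s x + s y" and mult: "s (x * y) = s x * s y" if "x \<in> K" "y \<in> K" for x y
      using ring_hom_add[OF s(1)] ring_hom_mult[OF s(1)] that unfolding K_def by auto
    have multK: "x * y \<in> K" if "x \<in> K" "y \<in> K" for x y
    proof -
      obtain f g where fg: "x = rat_eval f (omega p)" "y = rat_eval g (omega p)"
        using \<open>x \<in> K\<close> \<open>y \<in> K\<close> unfolding K_def car by blast
      show ?thesis using K[of "f * g"] by (simp add: fg map_poly_of_rat_mult)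
    qed
    have eval: "s (rat_eval f (omega p)) = rat_eval f (s (omega p))" for f
    proof (induction f)
      case 0
      show ?case using s(4)[of 0] by simp
    next
      case (pCons a f)
      show ?case
        using pCons(2) by (simp add: map_poly_pCons add mult rat om K multK s(4))
    qed
    have "s (omega p) ^ p = 1"
      using eval[of "[:0, 1:] ^ p"] s(4)[of 1] p_bounds by (simp add: rat_eval_power map_poly_pCons)
    then obtain a where a: "a < p" "s (omega p) = omega p ^ a"
      using unity_root_omega_power p_bounds by metis
    \<comment> \<open>Otherwise omega and 1 would have the same image, against injectivity.\<close>
    have "a \<noteq> 0"
    proof
      assume "a = 0"
      then have "s (omega p) = s 1" using a s(4)[of 1] by simp
      then have "omega p = 1" using s(2) om rat[of 1] by (auto simp: K_def dest: inj_onD)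
      then show False using omega_power_eq_1_iff[of p 1] p_bounds by simp
    qed
    then have a': "a \<in> {1..p-1}" using a by auto
    have "s = cyclotomic_aut p a"
    \<comment> \<open>Both functions take the value \<open>undefined\<close> off the field, so
      agreement on the field suffices.\<close>
    proof (rule extensionalityI[OF s(3)])
      show "cyclotomic_aut p a \<in> extensional (carrier (cyclotomic_field p))"
        by (simp add: cyclotomic_aut_def)
      show "s x = cyclotomic_aut p a x" if "x \<in> carrier (cyclotomic_field p)" for x
        using that by (auto simp: car eval a cyclotomic_aut_rat_eval[OF a'])
    qed
    then show "s \<in> cyclotomic_aut p ` {1..p-1}" using a' by blast
  qed
qed

lemma inj_on_cyclotomic_aut: "inj_on (cyclotomic_aut p) {1..p-1}"
proof (rule inj_onI)
  fix a b assume ab: "a \<in> {1..p-1}" "b \<in> {1..p-1}" "cyclotomic_aut p a = cyclotomic_aut p b"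
  have "omega p ^ a = omega p ^ b"
    using cyclotomic_aut_rat_eval[OF ab(1), of "[:0, 1:]"] cyclotomic_aut_rat_eval[OF ab(2), of "[:0, 1:]"] ab(3)
    by (simp add: map_poly_pCons)
  then show "a = b"
    using bij_betw_roots_unity[OF p_bounds(1)] ab(1,2)
    unfolding bij_betw_def omega_power by (auto dest!: inj_onD)
qed

section \<open>Traces and the trace norm in coordinates\<close>

lemma cyc_trace_rat_eval:
  "cyc_trace p (rat_eval f (omega p)) = (\<Sum>a=1..p-1. rat_eval f (omega p ^ a))"
  unfolding cyc_trace_def galois_group_eq
  by (subst sum.reindex[OF inj_on_cyclotomic_aut]) (simp add: cyclotomic_aut_rat_eval)

text \<open>If \<open>p\<close> does not divide \<open>m\<close>, the full geometric sum over 0,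
  ..., p - 1 vanishes; leaving out the term 1 at exponent 0 gives -1.\<close>

lemma sum_omega_powers:
  "(\<Sum>a=1..p-1. (omega p ^ m) ^ a) = (if p dvd m then of_nat p - 1 else -1)"
proof (cases "p dvd m")
  case True
  then have "omega p ^ m = 1" using omega_power_eq_1_iff p_bounds by blast
  then show ?thesis using True p_bounds by (simp add: of_nat_diff)
next
  case False
  have "(\<Sum>a<p. (omega p ^ m) ^ a) = ((omega p ^ m) ^ p - 1) / (omega p ^ m - 1)"
    using False p_bounds by (intro geometric_sum) (simp add: omega_power_eq_1_iff)
  also have "(omega p ^ m) ^ p = 1"
    using p_bounds by (metis omega_power_p power_mult mult.commute power_one)
  finally have "(\<Sum>a<p. (omega p ^ m) ^ a) = 0" by simp
  moreover have "(\<Sum>a<p. (omega p ^ m) ^ a) = 1 + (\<Sum>a=1..p-1. (omega p ^ m) ^ a)"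
  proof -
    have "{..<p} = insert 0 {1..p-1}" using p_bounds by auto
    then show ?thesis by simp
  qed
  ultimately show ?thesis using False by (simp add: add_eq_0_iff)
qed

lemma cyc_trace_cyclotomic_integer:
  assumes k: "k \<in> {1..p-1}"
  shows "cyc_trace p ((\<Sum>j=1..p-1. of_int (c j) * omega p ^ j) * omega p ^ k)
    = of_int (int p * c (p - k) - (\<Sum>j=1..p-1. c j))"
proof -
  define f where "f = (\<Sum>j=1..p-1. [:of_int (c j):] * [:0, 1:] ^ (j + k) :: rat poly)"
  have f: "rat_eval f z = (\<Sum>j=1..p-1. of_int (c j) * z ^ (j + k))" for z
    by (simp add: f_def rat_eval_sum map_poly_of_rat_mult rat_eval_power map_poly_pCons
          del: mult_pCons_left mult_pCons_right)
  have "cyc_trace p ((\<Sum>j=1..p-1. of_int (c j) * omega p ^ j) * omega p ^ k)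
      = cyc_trace p (rat_eval f (omega p))"
    by (simp add: f sum_distrib_right power_add mult.assoc)
  also have "\<dots> = (\<Sum>a=1..p-1. rat_eval f (omega p ^ a))"
    by (rule cyc_trace_rat_eval)
  also have "\<dots> = (\<Sum>a=1..p-1. \<Sum>j=1..p-1. of_int (c j) * (omega p ^ a) ^ (j + k))"
    by (simp only: f)
  also have "\<dots> = (\<Sum>j=1..p-1. of_int (c j) * (\<Sum>a=1..p-1. (omega p ^ (j + k)) ^ a))"
    by (subst sum.swap) (simp add: sum_distrib_left mult.commute flip: power_mult)
  also have "\<dots> = (\<Sum>j=1..p-1. of_int (if j = p - k then int p * c j - c j else - c j))"
  proof (rule sum.cong[OF refl])
    fix j assume j: "j \<in> {1..p-1}"
    \<comment> \<open>Here \<open>j + k\<close> is positive and less than 2p, so \<open>p\<close> is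
      its only possible value divisible by \<open>p\<close>.\<close>
    have "p dvd j + k \<longleftrightarrow> j = p - k"
    proof
      assume "p dvd j + k"
      then obtain q where q: "j + k = p * q" ..
      have "p * q < p * 2" using j k q[symmetric] by auto
      moreover have "q \<noteq> 0" using q j by (intro notI) auto
      ultimately have "q = 1" by auto
      then show "j = p - k" using q by simp
    qed (use k in auto)
    then show "of_int (c j) * (\<Sum>a=1..p-1. (omega p ^ (j + k)) ^ a)
        = (of_int (if j = p - k then int p * c j - c j else - c j) :: complex)"
      by (simp only: sum_omega_powers) (simp add: algebra_simps)
  qed
  also have "\<dots> = of_int (\<Sum>j=1..p-1. (if j = p - k then int p * c j else 0) - c j)"
    unfolding of_int_sum by (rule sum.cong) auto
  also have "(\<Sum>j=1..p-1. (if j = p - k then int p * c j else 0) - c j)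
      = int p * c (p - k) - (\<Sum>j=1..p-1. c j)"
    using k by (subst sum_subtractf) auto
  finally show ?thesis .
qed

text \<open>The reflection k -> p - k permutes the indices. Expanding the squares (p c_k - S)^2
  leaves S^2 with the factor -2p + (p - 1) = -(p + 1).\<close>

lemma trace_norm_cyclotomic_integer:
  "(trace_norm p (\<Sum>j=1..p-1. of_int (c j) * omega p ^ j))\<^sup>2
    = (real p)\<^sup>2 * (\<Sum>j=1..p-1. (of_int (c j))\<^sup>2) - (real p + 1) * (\<Sum>j=1..p-1. of_int (c j))\<^sup>2"
proof -
  define S where "S = (\<Sum>j=1..p-1. real_of_int (c j))"
  have "(trace_norm p (\<Sum>j=1..p-1. of_int (c j) * omega p ^ j))\<^sup>2
      = (\<Sum>k=1..p-1. (Re (cyc_trace p ((\<Sum>j=1..p-1. of_int (c j) * omega p ^ j) * omega p ^ k)))\<^sup>2)"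
    unfolding trace_norm_def by (rule real_sqrt_pow2) (simp add: sum_nonneg)
  also have "\<dots> = (\<Sum>k=1..p-1. (real p * of_int (c (p - k)) - S)\<^sup>2)"
    by (rule sum.cong[OF refl]) (simp only: cyc_trace_cyclotomic_integer, simp add: S_def)
  also have "\<dots> = (\<Sum>k=1..p-1. (real p * of_int (c k) - S)\<^sup>2)"
    by (rule sum.reindex_bij_witness[of _ "\<lambda>k. p - k" "\<lambda>k. p - k"]) auto
  also have "\<dots> = (\<Sum>k=1..p-1. (real p)\<^sup>2 * (of_int (c k))\<^sup>2 - 2 * real p * S * of_int (c k) + S\<^sup>2)"
    by (rule sum.cong) (simp_all add: power2_eq_square algebra_simps)
  also have "\<dots> = (real p)\<^sup>2 * (\<Sum>k=1..p-1. (of_int (c k))\<^sup>2) - 2 * real p * S * S + real (p - 1) * S\<^sup>2"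
    by (simp add: sum.distrib sum_subtractf S_def flip: sum_distrib_left)
  also have "\<dots> = (real p)\<^sup>2 * (\<Sum>k=1..p-1. (of_int (c k))\<^sup>2) - (real p + 1) * S\<^sup>2"
    using p_bounds by (simp add: of_nat_diff power2_eq_square algebra_simps)
  finally show ?thesis unfolding S_def .
qed

text \<open>All traces of 0 vanish, so p c_k = S for every \<open>k\<close>. Summing over
  \<open>k\<close> gives p S = (p - 1) S, hence S = 0 and every coefficient is 0.\<close>

lemma omega_powers_independent:
  assumes "(\<Sum>j=1..p-1. of_int (c j) * omega p ^ j) = 0" "j \<in> {1..p-1}"
  shows "c j = 0"
proof -
  define S where "S = (\<Sum>j=1..p-1. c j)"
  have zero: "cyc_trace p 0 = 0"
    using cyc_trace_rat_eval[of 0] by simp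
  have *: "int p * c k = S" if "k \<in> {1..p-1}" for k
  proof -
    have "p - k \<in> {1..p-1}" and "p - (p - k) = k" using that by auto
    then have "of_int (int p * c k - S) = (0 :: complex)"
      using cyc_trace_cyclotomic_integer[of "p - k" c] unfolding assms(1) S_def by (simp add: zero)
    then have "int p * c k - S = 0" by (rule of_int_eq_0_iff[THEN iffD1])
    then show ?thesis by simp
  qed
  have "int p * S = (\<Sum>k=1..p-1. int p * c k)" by (simp add: S_def sum_distrib_left)
  also have "\<dots> = (\<Sum>k=1..p-1. S)" by (rule sum.cong[OF refl]) (rule *)
  also have "\<dots> = (int p - 1) * S" using p_bounds by (simp add: of_nat_diff)
  finally have "S = 0" by (simp add: algebra_simps)
  then show ?thesis using *[OF assms(2)] p_bounds by simp
qed

end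

subsection \<open>Moments of the squared distance\<close>

text \<open>Extensional functions, so that distinct elements differ on \<open>J\<close> and a finite
  \<open>J\<close> gives a finite set.\<close>

abbreviation sign_vectors :: "'a set \<Rightarrow> ('a \<Rightarrow> int) set" where
  "sign_vectors J \<equiv> J \<rightarrow>\<^sub>E {-1, 1}"

lemma card_sign_vectors: "finite J \<Longrightarrow> card (sign_vectors J) = 2 ^ card J"
  by (simp add: card_funcsetE numeral_2_eq_2)

lemma sign_vectors_cases: "a \<in> sign_vectors J \<Longrightarrow> j \<in> J \<Longrightarrow> a j = -1 \<or> a j = 1"
  by (auto dest: PiE_mem)

lemma sign_vectors_square: "a \<in> sign_vectors J \<Longrightarrow> j \<in> J \<Longrightarrow> (a j)\<^sup>2 = 1"
  by (auto dest: sign_vectors_cases)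

text \<open>Splits off one independent sign; this drives the inductions for both moments.\<close>

lemma sum_sign_vectors_insert:
  assumes "x \<notin> J"
  shows "(\<Sum>a\<in>sign_vectors (insert x J). F a) = (\<Sum>a\<in>sign_vectors J. F (a(x := -1)) + F (a(x := 1)))"
proof -
  have "(\<Sum>a\<in>sign_vectors (insert x J). F a) = (\<Sum>(s, a)\<in>{-1, 1} \<times> sign_vectors J. F (a(x := s)))"
    unfolding PiE_insert_eq using inj_combinator[OF assms, of "\<lambda>_. {-1, 1 :: int}"]
    by (subst sum.reindex) (auto simp: case_prod_unfold)
  then show ?thesis
    by (simp add: sum.distrib flip: sum.cartesian_product)
qed

lemma sum_fun_upd:
  "x \<notin> J \<Longrightarrow> (\<Sum>j\<in>J. f j (if j = x then s else a j)) = (\<Sum>j\<in>J. f j (a j))"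
  by (rule sum.cong) auto

text \<open>The cross terms cancel when a sign is added: (s - t)^2 + (s + t)^2 = 2 s^2 + 2 for t^2 =
  1. The weights \<open>t\<close> are general in order to cover the inner product with a fixed sign
  vector as well as the plain sum.\<close>

lemma sign_vectors_second_moment:
  assumes "finite J" "\<And>j. j \<in> J \<Longrightarrow> (t j)\<^sup>2 = (1 :: int)"
  shows "(\<Sum>a\<in>sign_vectors J. (\<Sum>j\<in>J. a j * t j)\<^sup>2) = int (card J) * 2 ^ card J"
  using assms
proof (induction J rule: finite_induct)
  case (insert x J)
  have t: "t x * t x = 1" using insert.prems by (simp add: power2_eq_square)
  have "(\<Sum>a\<in>sign_vectors (insert x J). (\<Sum>j\<in>insert x J. a j * t j)\<^sup>2)
      = (\<Sum>a\<in>sign_vectors J. (- t x + (\<Sum>j\<in>J. a j * t j))\<^sup>2 + (t x + (\<Sum>j\<in>J. a j * t j))\<^sup>2)"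
    using insert.hyps by (simp add: sum_sign_vectors_insert sum_fun_upd[where f = "\<lambda>j s. s * t j"])
  also have "\<dots> = (\<Sum>a\<in>sign_vectors J. 2 * (\<Sum>j\<in>J. a j * t j)\<^sup>2 + 2)"
    using t by (intro sum.cong) (simp_all add: power2_eq_square algebra_simps)
  also have "\<dots> = 2 * (int (card J) * 2 ^ card J) + 2 * 2 ^ card J"
    using insert by (simp add: sum.distrib card_sign_vectors flip: sum_distrib_left)
  finally show ?case using insert.hyps by (simp add: algebra_simps)
qed simp

text \<open>Odd powers cancel in (s - 1)^4 + (s + 1)^4 = 2 s^4 + 12 s^2 + 2, so the induction closes
  with the help of the second moment.\<close>

lemma sign_vectors_fourth_moment:
  assumes "finite J"
  shows "(\<Sum>a\<in>sign_vectors J. (\<Sum>j\<in>J. a j) ^ 4) = (3 * (int (card J))\<^sup>2 - 2 * int (card J)) * 2 ^ card J"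
  using assms
proof (induction J rule: finite_induct)
  case (insert x J)
  have fourth: "(- 1 + s) ^ 4 + (1 + s) ^ 4 = 2 * s ^ 4 + 12 * s\<^sup>2 + 2" for s :: int
    by (simp add: power4_eq_xxxx power2_eq_square algebra_simps)
  have "(\<Sum>a\<in>sign_vectors (insert x J). (\<Sum>j\<in>insert x J. a j) ^ 4)
      = (\<Sum>a\<in>sign_vectors J. (- 1 + (\<Sum>j\<in>J. a j)) ^ 4 + (1 + (\<Sum>j\<in>J. a j)) ^ 4)"
    using insert.hyps by (simp add: sum_sign_vectors_insert sum_fun_upd[where f = "\<lambda>j s. s"])
  also have "\<dots> = (\<Sum>a\<in>sign_vectors J. 2 * (\<Sum>j\<in>J. a j) ^ 4 + 12 * (\<Sum>j\<in>J. a j)\<^sup>2 + 2)"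
    by (simp only: fourth)
  also have "\<dots> = 2 * ((3 * (int (card J))\<^sup>2 - 2 * int (card J)) * 2 ^ card J)
      + 12 * (int (card J) * 2 ^ card J) + 2 * 2 ^ card J"
    using insert sign_vectors_second_moment[OF insert.hyps(1), of "\<lambda>_. 1"]
    by (simp add: sum.distrib card_sign_vectors flip: sum_distrib_left)
  finally show ?case using insert.hyps by (simp add: power2_eq_square algebra_simps)
qed simp

section \<open>Vertices as sign vectors and their distances\<close>

definition vertex :: "nat \<Rightarrow> nat \<Rightarrow> (nat \<Rightarrow> int) \<Rightarrow> complex" where
  "vertex p N a = (\<Sum>j=1..p-1. of_int (int N * a j) * omega p ^ j)"

lemma vertices_eq: "vertices p N = vertex p N ` sign_vectors {1..p-1}"
proof
  show "vertices p N \<subseteq> vertex p N ` sign_vectors {1..p-1}"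
  proof
    fix x assume "x \<in> vertices p N"
    then obtain a where a: "x = (\<Sum>j=1..p-1. of_int (a j) * omega p ^ j)"
        "\<forall>j\<in>{1..p-1}. a j \<in> {- int N, int N}"
      by (auto simp: vertices_def)
    \<comment> \<open>Comparing with \<open>int N\<close> yields a valid sign also for N = 0, where
      the two permitted values coincide.\<close>
    define b where "b = (\<lambda>j\<in>{1..p-1}. if a j = int N then 1 else -1 :: int)"
    have "b \<in> sign_vectors {1..p-1}" by (auto simp: b_def)
    moreover have "x = vertex p N b"
      unfolding vertex_def a(1)
    proof (rule sum.cong[OF refl])
      fix j assume j: "j \<in> {1..p-1}"
      then have "a j = int N * b j" using a(2) by (auto simp: b_def)
      then show "of_int (a j) * omega p ^ j = of_int (int N * b j) * omega p ^ j" by simp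
    qed
    ultimately show "x \<in> vertex p N ` sign_vectors {1..p-1}" by blast
  qed
  show "vertex p N ` sign_vectors {1..p-1} \<subseteq> vertices p N"
  proof
    fix x assume "x \<in> vertex p N ` sign_vectors {1..p-1}"
    then obtain a where a: "a \<in> sign_vectors {1..p-1}" "x = vertex p N a" by blast
    have "\<forall>j\<in>{1..p-1}. int N * a j \<in> {- int N, int N}"
      using sign_vectors_cases[OF a(1)] by fastforce
    then show "x \<in> vertices p N"
      unfolding a(2) vertex_def vertices_def mem_Collect_eq by (intro exI[of _ "\<lambda>j. int N * a j"]) simp
  qed
qed

text \<open>The difference of two vertices has integer coefficients N (a_j - b_j), which
  independence of the powers of omega forces to vanish.\<close>

lemma inj_on_vertex:
  assumes "Factorial_Ring.prime p" "N \<ge> 1"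
  shows "inj_on (vertex p N) (sign_vectors {1..p-1})"
proof (rule inj_onI)
  fix a b assume ab: "a \<in> sign_vectors {1..p-1}" "b \<in> sign_vectors {1..p-1}" "vertex p N a = vertex p N b"
  have "(\<Sum>j=1..p-1. of_int (int N * (a j - b j)) * omega p ^ j) = vertex p N a - vertex p N b"
    unfolding vertex_def sum_subtractf[symmetric] by (rule sum.cong) (simp_all add: algebra_simps)
  then have "int N * (a j - b j) = 0" if "j \<in> {1..p-1}" for j
    using omega_powers_independent[OF assms(1), of "\<lambda>j. int N * (a j - b j)"] ab(3) that by simp
  then have "a j = b j" if "j \<in> {1..p-1}" for j using that assms(2) by force
  then show "a = b" using ab by (intro PiE_ext) auto
qed

lemma card_vertices:
  assumes "Factorial_Ring.prime p" "N \<ge> 1"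
  shows "card (vertices p N) = 2 ^ (p - 1)"
  unfolding vertices_eq card_image[OF inj_on_vertex[OF assms]] by (simp add: card_sign_vectors)

text \<open>Apply the norm formula to c_j = N (b_j - a_j). Since (b_j - a_j)^2 = 2 - 2 a_j b_j for
  signs, the main term of the squared norm is 2 N^2 p^2 (p - 1), and the normalization 4 N^2 p^2 (p
  - 1) turns it into 1/2.\<close>

lemma ndist_vertex:
  assumes p: "Factorial_Ring.prime p" and N: "N \<ge> 1"
    and a: "a \<in> sign_vectors {1..p-1}" and b: "b \<in> sign_vectors {1..p-1}"
  shows "(ndist p N (vertex p N a) (vertex p N b))\<^sup>2 - 1 / 2
    = - of_int (\<Sum>j=1..p-1. a j * b j) / (2 * (real p - 1))
      - (real p + 1) * of_int ((\<Sum>j=1..p-1. b j) - (\<Sum>j=1..p-1. a j)) ^ 2 / (4 * (real p)\<^sup>2 * (real p - 1))"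
proof -
  define Y where "Y = real_of_int (\<Sum>j=1..p-1. a j * b j)"
  define S where "S = real_of_int ((\<Sum>j=1..p-1. b j) - (\<Sum>j=1..p-1. a j))"
  have p1: "real p > 1" using p prime_gt_1_nat by simp
  have sq: "(a j)\<^sup>2 = 1" "(b j)\<^sup>2 = 1" if "j \<in> {1..p-1}" for j
    by (rule sign_vectors_square[OF a that], rule sign_vectors_square[OF b that])
  have "vertex p N b - vertex p N a = (\<Sum>j=1..p-1. of_int (int N * (b j - a j)) * omega p ^ j)"
    unfolding vertex_def sum_subtractf[symmetric] by (rule sum.cong) (simp_all add: algebra_simps)
  then have "(trace_norm p (vertex p N b - vertex p N a))\<^sup>2
      = (real p)\<^sup>2 * (\<Sum>j=1..p-1. (of_int (int N * (b j - a j)))\<^sup>2)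
        - (real p + 1) * (\<Sum>j=1..p-1. of_int (int N * (b j - a j)))\<^sup>2"
    using trace_norm_cyclotomic_integer[OF p, of "\<lambda>j. int N * (b j - a j)"] by simp
  also have "(\<Sum>j=1..p-1. of_int (int N * (b j - a j))) = real N * S"
    by (simp add: S_def sum_subtractf flip: sum_distrib_left)
  also have "(\<Sum>j=1..p-1. (real_of_int (int N * (b j - a j)))\<^sup>2) = (real N)\<^sup>2 * (2 * (real p - 1) - 2 * Y)"
  proof -
    have "(\<Sum>j=1..p-1. (int N * (b j - a j))\<^sup>2) = (\<Sum>j=1..p-1. (int N)\<^sup>2 * (2 - 2 * (a j * b j)))"
    proof (rule sum.cong[OF refl])
      fix j assume "j \<in> {1..p-1}"
      then show "(int N * (b j - a j))\<^sup>2 = (int N)\<^sup>2 * (2 - 2 * (a j * b j))"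
        using sq[of j] by (simp add: power_mult_distrib power2_diff mult_ac)
    qed
    also have "\<dots> = (int N)\<^sup>2 * (2 * (int p - 1) - 2 * (\<Sum>j=1..p-1. a j * b j))"
      using p1 by (simp add: sum_subtractf of_nat_diff flip: sum_distrib_left)
    finally have "real_of_int (\<Sum>j=1..p-1. (int N * (b j - a j))\<^sup>2)
        = of_int ((int N)\<^sup>2 * (2 * (int p - 1) - 2 * (\<Sum>j=1..p-1. a j * b j)))"
      by (rule arg_cong)
    then show ?thesis by (simp add: Y_def)
  qed
  finally have tn: "(trace_norm p (vertex p N b - vertex p N a))\<^sup>2
      = (real N)\<^sup>2 * ((real p)\<^sup>2 * (2 * (real p - 1) - 2 * Y) - (real p + 1) * S\<^sup>2)"
    by (simp add: algebra_simps)
  have "(ndist p N (vertex p N a) (vertex p N b))\<^sup>2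
      = (real N)\<^sup>2 * ((real p)\<^sup>2 * (2 * (real p - 1) - 2 * Y) - (real p + 1) * S\<^sup>2)
        / (4 * (real N)\<^sup>2 * (real p)\<^sup>2 * (real p - 1))"
    unfolding ndist_def power_divide tn using p1 by (simp add: power_mult_distrib)
  also have "\<dots> - 1 / 2 = - Y / (2 * (real p - 1)) - (real p + 1) * S\<^sup>2 / (4 * (real p)\<^sup>2 * (real p - 1))"
  proof -
    have "real N \<noteq> 0" "real p \<noteq> 0" "real p - 1 \<noteq> 0" using N p1 by auto
    then show ?thesis by (simp add: divide_simps) (simp add: algebra_simps)
  qed
  finally show ?thesis unfolding Y_def S_def .
qed

text \<open>Repeated use of (x + y)^2 <= 2 (x^2 + y^2) separates the two error terms and then
  decouples the coordinate sums of \<open>a\<close> and \<open>b\<close>, so that the moments can be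
  applied one vector at a time.\<close>

lemma ndist_vertex_deviation:
  assumes p: "Factorial_Ring.prime p" "p \<ge> 3" and N: "N \<ge> 1"
    and a: "a \<in> sign_vectors {1..p-1}" and b: "b \<in> sign_vectors {1..p-1}"
  shows "((ndist p N (vertex p N a) (vertex p N b))\<^sup>2 - 1 / 2)\<^sup>2
    \<le> of_int ((\<Sum>j=1..p-1. a j * b j)\<^sup>2) / (2 * (real p - 1)\<^sup>2)
      + (real p + 1)\<^sup>2 / ((real p) ^ 4 * (real p - 1)\<^sup>2)
        * of_int ((\<Sum>j=1..p-1. a j) ^ 4 + (\<Sum>j=1..p-1. b j) ^ 4)"
proof -
  define Y where "Y = real_of_int (\<Sum>j=1..p-1. a j * b j)"
  define A where "A = real_of_int (\<Sum>j=1..p-1. a j)"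
  define B where "B = real_of_int (\<Sum>j=1..p-1. b j)"
  define u where "u = Y / (2 * (real p - 1))"
  define c where "c = (real p + 1) / (4 * (real p)\<^sup>2 * (real p - 1))"
  have sum_sq: "(x + y)\<^sup>2 \<le> 2 * (x\<^sup>2 + y\<^sup>2)" "(x - y)\<^sup>2 \<le> 2 * (x\<^sup>2 + y\<^sup>2)" for x y :: real
    using zero_le_power2[of "x - y"] zero_le_power2[of "x + y"] by (auto simp: power2_eq_square algebra_simps)
  have "(B - A) ^ 4 = ((B - A)\<^sup>2)\<^sup>2" by simp
  also have "\<dots> \<le> (2 * (B\<^sup>2 + A\<^sup>2))\<^sup>2" by (rule power_mono[OF sum_sq(2)]) simp
  also have "\<dots> = 4 * (B\<^sup>2 + A\<^sup>2)\<^sup>2" by (simp only: power_mult_distrib) simp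
  also have "\<dots> \<le> 8 * (A ^ 4 + B ^ 4)" using sum_sq(1)[of "B\<^sup>2" "A\<^sup>2"] by simp
  finally have fourth: "(B - A) ^ 4 \<le> 8 * (A ^ 4 + B ^ 4)" .
  have "((ndist p N (vertex p N a) (vertex p N b))\<^sup>2 - 1 / 2)\<^sup>2 = (u + c * (B - A)\<^sup>2)\<^sup>2"
    \<comment> \<open>The deviation is the negative of the squared expression on the right.\<close>
    unfolding ndist_vertex[OF p(1) N a b] power2_eq_iff
    by (simp add: u_def c_def Y_def A_def B_def)
  also have "\<dots> \<le> 2 * (u\<^sup>2 + (c * (B - A)\<^sup>2)\<^sup>2)" by (rule sum_sq)
  also have "\<dots> = 2 * u\<^sup>2 + 2 * c\<^sup>2 * (B - A) ^ 4" by (simp add: power_mult_distrib)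
  also have "\<dots> \<le> 2 * u\<^sup>2 + 2 * c\<^sup>2 * (8 * (A ^ 4 + B ^ 4))"
    by (intro add_left_mono mult_left_mono fourth) simp
  also have "\<dots> = Y\<^sup>2 / (2 * (real p - 1)\<^sup>2) + (real p + 1)\<^sup>2 / ((real p) ^ 4 * (real p - 1)\<^sup>2) * (A ^ 4 + B ^ 4)"
  proof -
    have id: "2 * (y / (2 * q))\<^sup>2 + 2 * (r / (4 * s\<^sup>2 * q))\<^sup>2 * (8 * w) = y\<^sup>2 / (2 * q\<^sup>2) + r\<^sup>2 / (s ^ 4 * q\<^sup>2) * w"
      for y q r s w :: real
      by (simp add: power_divide power_mult_distrib)
    show ?thesis unfolding u_def c_def by (rule id)
  qed
  finally show ?thesis by (simp add: Y_def A_def B_def)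
qed

text \<open>The inner products contribute through the second moment (p - 1), the coordinate sums
  through the fourth moment, at most 3 (p - 1)^2. For p >= 3 the total mean 1 / (2 (p - 1)) + 6 (p +
  1)^2 / p^4 is at most 5 / p.\<close>

lemma sum_ndist_deviation:
  assumes p: "Factorial_Ring.prime p" "p \<ge> 3" and N: "N \<ge> 1"
  shows "(\<Sum>\<alpha>\<in>vertices p N. \<Sum>\<beta>\<in>vertices p N. ((ndist p N \<alpha> \<beta>)\<^sup>2 - 1 / 2)\<^sup>2)
    \<le> 5 / real p * (real (card (vertices p N)))\<^sup>2"
proof -
  define J where "J = {1..p-1}"
  define SV where "SV = sign_vectors J"
  define M :: real where "M = 2 ^ (p - 1)"
  define c where "c = (real p + 1)\<^sup>2 / ((real p) ^ 4 * (real p - 1)\<^sup>2)"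
  have J: "finite J" "card J = p - 1" by (simp_all add: J_def)
  have cardSV: "real (card SV) = M" by (simp add: SV_def card_sign_vectors J M_def)
  have n: "real (p - 1) = real p - 1" using p by simp
  have second: "(\<Sum>b\<in>SV. real_of_int ((\<Sum>j\<in>J. a j * b j)\<^sup>2)) = (real p - 1) * M" if "a \<in> SV" for a
  proof -
    have "(\<Sum>b\<in>SV. (\<Sum>j\<in>J. b j * a j)\<^sup>2) = int (card J) * 2 ^ card J"
      unfolding SV_def
      by (rule sign_vectors_second_moment) (use that J sign_vectors_square in \<open>auto simp: SV_def\<close>)
    then have "real_of_int (\<Sum>b\<in>SV. (\<Sum>j\<in>J. b j * a j)\<^sup>2) = of_int (int (card J) * 2 ^ card J)"
      by (rule arg_cong)
    then show ?thesis by (simp add: J n M_def mult.commute del: One_nat_def)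
  qed
  have fourth: "(\<Sum>a\<in>SV. real_of_int ((\<Sum>j\<in>J. a j) ^ 4)) \<le> 3 * (real p - 1)\<^sup>2 * M"
  proof -
    have "(\<Sum>a\<in>SV. (\<Sum>j\<in>J. a j) ^ 4) = (3 * (int (card J))\<^sup>2 - 2 * int (card J)) * 2 ^ card J"
      unfolding SV_def by (rule sign_vectors_fourth_moment) (rule J)
    also have "\<dots> \<le> 3 * (int (card J))\<^sup>2 * 2 ^ card J" by (intro mult_right_mono) auto
    finally have "real_of_int (\<Sum>a\<in>SV. (\<Sum>j\<in>J. a j) ^ 4) \<le> of_int (3 * (int (card J))\<^sup>2 * 2 ^ card J)"
      by (rule of_int_le_iff[THEN iffD2])
    then show ?thesis by (simp add: J n M_def del: One_nat_def)
  qed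
  have "(\<Sum>\<alpha>\<in>vertices p N. \<Sum>\<beta>\<in>vertices p N. ((ndist p N \<alpha> \<beta>)\<^sup>2 - 1 / 2)\<^sup>2)
      = (\<Sum>a\<in>SV. \<Sum>b\<in>SV. ((ndist p N (vertex p N a) (vertex p N b))\<^sup>2 - 1 / 2)\<^sup>2)"
    unfolding vertices_eq SV_def J_def sum.reindex[OF inj_on_vertex[OF p(1) N]] o_def ..
  also have "\<dots> \<le> (\<Sum>a\<in>SV. \<Sum>b\<in>SV. of_int ((\<Sum>j\<in>J. a j * b j)\<^sup>2) / (2 * (real p - 1)\<^sup>2)
      + c * of_int ((\<Sum>j\<in>J. a j) ^ 4 + (\<Sum>j\<in>J. b j) ^ 4))"
    unfolding c_def J_def by (intro sum_mono ndist_vertex_deviation p N) (simp_all add: SV_def J_def)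
  \<comment> \<open>Each fourth power depends on one of the two vectors only and is repeated
    \<open>M\<close> times; by symmetry both give the same sum, whence \<open>2 * M\<close>.\<close>
  also have "\<dots> = (\<Sum>a\<in>SV. \<Sum>b\<in>SV. of_int ((\<Sum>j\<in>J. a j * b j)\<^sup>2)) / (2 * (real p - 1)\<^sup>2)
      + c * (2 * M * (\<Sum>a\<in>SV. of_int ((\<Sum>j\<in>J. a j) ^ 4)))"
    by (simp add: sum.distrib sum_divide_distrib sum_distrib_left distrib_left mult_ac flip: cardSV)
  also have "\<dots> \<le> (\<Sum>a\<in>SV. (real p - 1) * M) / (2 * (real p - 1)\<^sup>2) + c * (2 * M * (3 * (real p - 1)\<^sup>2 * M))"
    using fourth by (intro add_mono divide_right_mono mult_left_mono sum_mono)
      (simp_all only: second, simp_all add: c_def M_def)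
  also have "\<dots> = (1 / (2 * (real p - 1)) + 6 * (real p + 1)\<^sup>2 / (real p) ^ 4) * M\<^sup>2"
  proof -
    have id: "m * (q * m) / (2 * q\<^sup>2) + r / (s * q\<^sup>2) * (2 * m * (3 * q\<^sup>2 * m)) = (1 / (2 * q) + 6 * r / s) * m\<^sup>2"
      if "q \<noteq> 0" "s \<noteq> 0" for m q r s :: real
      using that by (simp add: field_simps power2_eq_square)
    show ?thesis unfolding c_def sum_constant cardSV by (rule id) (use p in auto)
  qed
  also have "\<dots> \<le> 5 / real p * M\<^sup>2"
  proof (intro mult_right_mono)
    \<comment> \<open>From p - 1 >= 2p/3 and p + 1 <= 4p/3 the two terms are at most (3/4) / p and
      (32/9) / p, and 3/4 + 32/9 < 5.\<close>
    have p3: "real p \<ge> 3" using p by simp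
    have "1 / (2 * (real p - 1)) \<le> 3 / 4 / real p"
      using p3 by (simp add: field_simps)
    moreover have "6 * (real p + 1)\<^sup>2 / (real p) ^ 4 \<le> 32 / 9 / real p"
    proof -
      have "(real p + 1)\<^sup>2 \<le> (4 / 3 * real p)\<^sup>2" using p3 by (intro power_mono) auto
      then have "6 * (real p + 1)\<^sup>2 / (real p) ^ 4 \<le> 6 * (4 / 3 * real p)\<^sup>2 / (real p) ^ 4"
        by (intro divide_right_mono) auto
      also have "\<dots> = 32 / 3 / (real p * real p)"
        using p3 by (simp add: field_simps power2_eq_square power4_eq_xxxx)
      also have "\<dots> \<le> 32 / 3 / (3 * real p)"
        using p3 by (intro divide_left_mono mult_right_mono) auto
      finally show ?thesis by simp
    qed
    moreover have "3 / 4 / real p + 32 / 9 / real p \<le> 5 / real p"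
      using p3 by (simp add: field_simps)
    ultimately show "1 / (2 * (real p - 1)) + 6 * (real p + 1)\<^sup>2 / (real p) ^ 4 \<le> 5 / real p" by linarith
  qed simp
  finally show ?thesis using card_vertices[OF p(1) N] by (simp add: M_def)
qed

text \<open>Chebyshev's inequality. For d >= 0 the factorization d^2 - 1/2 = (d - 1/sqrt 2) (d +
  1/sqrt 2) has second factor at least 1/sqrt 2, so each bad pair has squared deviation at least 1 /
  (2 T^2). The mean bound 5 / p then becomes 10 T^2 / p.\<close>

lemma card_bad_pairs:
  assumes p: "Factorial_Ring.prime p" "p \<ge> 3" and N: "N \<ge> 1" and T: "T > 0"
  shows "real (card {(\<alpha>, \<beta>) \<in> vertices p N \<times> vertices p N. \<bar>ndist p N \<alpha> \<beta> - 1 / sqrt 2\<bar> > 1 / T})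
    \<le> 10 * T\<^sup>2 / real p * (real (card (vertices p N)))\<^sup>2"
proof -
  define V where "V = vertices p N"
  define B where "B = {(\<alpha>, \<beta>) \<in> V \<times> V. \<bar>ndist p N \<alpha> \<beta> - 1 / sqrt 2\<bar> > 1 / T}"
  define dev where "dev = (\<lambda>x. ((ndist p N (fst x) (snd x))\<^sup>2 - 1 / 2)\<^sup>2)"
  have "finite V" unfolding V_def vertices_eq by (intro finite_imageI finite_PiE) auto
  have "1 \<le> 2 * T\<^sup>2 * dev x" if "x \<in> B" for x
  proof -
    define d where "d = ndist p N (fst x) (snd x)"
    have "d \<ge> 0"
      using p by (auto simp: d_def ndist_def trace_norm_def intro!: divide_nonneg_nonneg sum_nonneg)
    have "1 / T < \<bar>d - 1 / sqrt 2\<bar>" using that by (auto simp: B_def d_def)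
    then have "1 < T * \<bar>d - 1 / sqrt 2\<bar>" using T by (simp add: field_simps)
    then have "1 * (1 / sqrt 2) \<le> (T * \<bar>d - 1 / sqrt 2\<bar>) * (d + 1 / sqrt 2)"
      using \<open>d \<ge> 0\<close> by (intro mult_mono) auto
    then have "(1 * (1 / sqrt 2))\<^sup>2 \<le> ((T * \<bar>d - 1 / sqrt 2\<bar>) * (d + 1 / sqrt 2))\<^sup>2"
      by (rule power_mono) simp
    also have "\<dots> = T\<^sup>2 * ((d - 1 / sqrt 2) * (d + 1 / sqrt 2))\<^sup>2"
      by (simp add: power_mult_distrib)
    also have "(d - 1 / sqrt 2) * (d + 1 / sqrt 2) = d\<^sup>2 - 1 / 2"
      by (simp add: algebra_simps power2_eq_square)
    finally show ?thesis by (simp add: dev_def d_def power_divide)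
  qed
  then have "(\<Sum>x\<in>B. 1) \<le> (\<Sum>x\<in>B. 2 * T\<^sup>2 * dev x)" by (rule sum_mono)
  also have "\<dots> \<le> (\<Sum>x\<in>V \<times> V. 2 * T\<^sup>2 * dev x)"
    using \<open>finite V\<close> by (intro sum_mono2) (auto simp: B_def dev_def)
  also have "\<dots> = 2 * T\<^sup>2 * (\<Sum>\<alpha>\<in>V. \<Sum>\<beta>\<in>V. ((ndist p N \<alpha> \<beta>)\<^sup>2 - 1 / 2)\<^sup>2)"
    by (simp add: sum_distrib_left dev_def sum.cartesian_product case_prod_unfold)
  also have "\<dots> \<le> 2 * T\<^sup>2 * (5 / real p * (real (card V))\<^sup>2)"
    using sum_ndist_deviation[OF p N] by (intro mult_left_mono) (auto simp: V_def)
  finally show ?thesis by (simp add: B_def V_def)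
qed

subsection \<open>Tuples of vertices\<close>

text \<open>A tuple is determined by its entries at \<open>j\<close> and \<open>k\<close>, which
  form an element of \<open>B\<close>, together with its restriction to the other indices.\<close>

lemma card_PiE_pair_le:
  assumes I: "finite I" "j \<in> I" "k \<in> I" "j \<noteq> k" and V: "finite V" and B: "B \<subseteq> V \<times> V"
  shows "card {\<beta> \<in> I \<rightarrow>\<^sub>E V. (\<beta> j, \<beta> k) \<in> B} \<le> card B * card V ^ (card I - 2)"
proof -
  let ?I = "I - {j, k}"
  have fin: "finite (B \<times> (?I \<rightarrow>\<^sub>E V))" using I V B by (auto intro: finite_subset finite_PiE)
  have "card {\<beta> \<in> I \<rightarrow>\<^sub>E V. (\<beta> j, \<beta> k) \<in> B} \<le> card (B \<times> (?I \<rightarrow>\<^sub>E V))"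
  proof (rule card_inj_on_le[OF _ _ fin])
    show "inj_on (\<lambda>\<beta>. ((\<beta> j, \<beta> k), restrict \<beta> ?I)) {\<beta> \<in> I \<rightarrow>\<^sub>E V. (\<beta> j, \<beta> k) \<in> B}"
    proof (rule inj_onI)
      fix \<beta> \<gamma> assume \<beta>: "\<beta> \<in> {\<beta> \<in> I \<rightarrow>\<^sub>E V. (\<beta> j, \<beta> k) \<in> B}" and \<gamma>: "\<gamma> \<in> {\<beta> \<in> I \<rightarrow>\<^sub>E V. (\<beta> j, \<beta> k) \<in> B}"
        and eq: "((\<beta> j, \<beta> k), restrict \<beta> ?I) = ((\<gamma> j, \<gamma> k), restrict \<gamma> ?I)"
      have "\<beta> i = \<gamma> i" if "i \<in> I" for i
      proof (cases "i \<in> {j, k}")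
        case False
        then show ?thesis using eq that by (metis (no_types, lifting) DiffI Pair_inject restrict_apply')
      qed (use eq in auto)
      then show "\<beta> = \<gamma>" using \<beta> \<gamma> by (intro PiE_ext[of \<beta> I "\<lambda>_. V"]) auto
    qed
    have "restrict \<beta> ?I \<in> ?I \<rightarrow>\<^sub>E V" if "\<beta> \<in> I \<rightarrow>\<^sub>E V" for \<beta>
      using that by (intro PiE_I) auto
    then show "(\<lambda>\<beta>. ((\<beta> j, \<beta> k), restrict \<beta> ?I)) ` {\<beta> \<in> I \<rightarrow>\<^sub>E V. (\<beta> j, \<beta> k) \<in> B}
        \<subseteq> B \<times> (?I \<rightarrow>\<^sub>E V)"
      by (intro image_subsetI) blast
  qed
  also have "card (B \<times> (?I \<rightarrow>\<^sub>E V)) = card B * card V ^ (card I - 2)"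
  proof -
    have "card {j, k} = 2" using I by simp
    then have "card ?I = card I - 2" using I card_Diff_subset[of "{j, k}" I] by simp
    then show ?thesis using I by (simp add: card_cartesian_product card_funcsetE)
  qed
  finally show ?thesis .
qed

text \<open>Union bound: each of the K (K - 1) ordered pairs of distinct indices excludes at most
  the proportion \<open>\<delta>\<close> of all tuples.\<close>

lemma card_tuples_avoiding_pairs:
  assumes V: "finite V" "V \<noteq> {}" and B: "B \<subseteq> V \<times> V" and K: "K \<ge> 2"
    and le: "real (card B) \<le> \<delta> * (real (card V))\<^sup>2"
  shows "real (card {\<beta> \<in> {1..K} \<rightarrow>\<^sub>E V. \<forall>j k. 1 \<le> j \<and> j < k \<and> k \<le> K \<longrightarrow> (\<beta> j, \<beta> k) \<notin> B})
    \<ge> (1 - real K * (real K - 1) * \<delta>) * real (card V) ^ K"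
proof -
  define W where "W = {1..K} \<rightarrow>\<^sub>E V"
  \<comment> \<open>Ordered pairs, twice as many as needed; the constant absorbs the factor.\<close>
  define P where "P = (SIGMA j:{1..K}. {1..K} - {j})"
  define G where "G = {\<beta> \<in> W. \<forall>j k. 1 \<le> j \<and> j < k \<and> k \<le> K \<longrightarrow> (\<beta> j, \<beta> k) \<notin> B}"
  define E where "E = (\<lambda>x. {\<beta> \<in> W. (\<beta> (fst x), \<beta> (snd x)) \<in> B})"
  have W: "finite W" "card W = card V ^ K"
    using V by (simp_all add: W_def finite_PiE card_funcsetE)
  have P: "finite P" "card P = K * (K - 1)"
    unfolding P_def by (auto simp: card_SigmaI)
  have pow: "(real (card V))\<^sup>2 * real (card V) ^ (K - 2) = real (card V) ^ K"
    unfolding power_add[symmetric] using K by (intro arg_cong2[where f = power]) auto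
  have "real (card (E x)) \<le> \<delta> * real (card V) ^ K" if xP: "x \<in> P" for x
  proof -
    obtain j k where x: "x = (j, k)" "j \<in> {1..K}" "k \<in> {1..K}" "j \<noteq> k"
      using xP unfolding P_def by blast
    have "card (E x) \<le> card B * card V ^ (K - 2)"
      using card_PiE_pair_le[OF finite_atLeastAtMost x(2-4) V(1) B] by (simp add: E_def W_def x(1))
    then have "real (card (E x)) \<le> real (card B * card V ^ (K - 2))" by (rule of_nat_mono)
    also have "\<dots> \<le> \<delta> * (real (card V))\<^sup>2 * real (card V) ^ (K - 2)"
      using le by (simp add: mult_right_mono)
    finally show ?thesis using pow by (simp add: mult.assoc)
  qed
  then have "(\<Sum>x\<in>P. real (card (E x))) \<le> (\<Sum>x\<in>P. \<delta> * real (card V) ^ K)" by (rule sum_mono)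
  also have "\<dots> = real K * (real K - 1) * \<delta> * real (card V) ^ K"
    using K by (simp add: P of_nat_diff)
  finally have sum: "(\<Sum>x\<in>P. real (card (E x))) \<le> real K * (real K - 1) * \<delta> * real (card V) ^ K" .
  \<comment> \<open>A tuple outside \<open>G\<close> has a bad pair at some j < k, and (j, k)
    belongs to \<open>P\<close>.\<close>
  have "W \<subseteq> G \<union> (\<Union>x\<in>P. E x)"
    by (fastforce simp: G_def E_def P_def)
  then have "card W \<le> card (G \<union> (\<Union>x\<in>P. E x))"
    using W P by (intro card_mono) (auto simp: G_def E_def)
  also have "\<dots> \<le> card G + card (\<Union>x\<in>P. E x)" by (rule card_Un_le)
  also have "\<dots> \<le> card G + (\<Sum>x\<in>P. card (E x))" using card_UN_le[OF P(1), of E] by simp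
  finally have "real (card W) \<le> real (card G + (\<Sum>x\<in>P. card (E x)))" by (rule of_nat_mono)
  then have "real (card V) ^ K \<le> real (card G) + real K * (real K - 1) * \<delta> * real (card V) ^ K"
    using sum by (simp add: W)
  then show ?thesis by (simp add: G_def W_def algebra_simps)
qed

theorem theorem9:
  shows "\<exists>C5 C6 :: real. C5 > 0 \<and> C6 > 0 \<and>
    (\<forall>(p::nat) (N::nat) (K::nat) (T::real).
      Factorial_Ring.prime p \<and> p \<ge> 3 \<and> N \<ge> 1 \<and> K \<ge> 2 \<and> 1 < T \<and> T \<le> C5 * real p \<longrightarrow>
      1 / real (card (vertices p N)) ^ K *
        real (card {\<beta> \<in> {1..K} \<rightarrow>\<^sub>E vertices p N.
          (MAX (j, k) \<in> {(j, k). 1 \<le> j \<and> j < k \<and> k \<le> K}.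
             \<bar>ndist p N (\<beta> j) (\<beta> k) - 1 / sqrt 2\<bar>) \<le> 1 / T})
      \<ge> 1 - C6 * real K * (real K - 1) * T\<^sup>2 / real p)"
proof (rule exI[of _ 1], rule exI[of _ 10], intro conjI allI impI)
  \<comment> \<open>The witnesses are C5 = 1 and C6 = 10; the latter is the constant in the bound
    for bad pairs.\<close>
  fix p N K :: nat and T :: real
  assume *: "Factorial_Ring.prime p \<and> p \<ge> 3 \<and> N \<ge> 1 \<and> K \<ge> 2 \<and> 1 < T \<and> T \<le> 1 * real p"
  define V where "V = vertices p N"
  define B where "B = {(\<alpha>, \<beta>) \<in> V \<times> V. \<bar>ndist p N \<alpha> \<beta> - 1 / sqrt 2\<bar> > 1 / T}"
  define P where "P = {(j, k). 1 \<le> j \<and> j < k \<and> k \<le> K}"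
  have "card V = 2 ^ (p - 1)" using * by (simp add: V_def card_vertices)
  then have V: "finite V" "V \<noteq> {}" "card V > 0" by (auto intro: card_ge_0_finite)
  \<comment> \<open>The maximum is governed by its individual entries only over a finite nonempty
    index set; K >= 2 supplies the pair (1, 2).\<close>
  have P: "finite P" "P \<noteq> {}"
  proof -
    have "P \<subseteq> {1..K} \<times> {1..K}" "(1, 2) \<in> P" using * by (auto simp: P_def)
    then show "finite P" "P \<noteq> {}" by (auto intro: finite_subset)
  qed
  have "(1 - real K * (real K - 1) * (10 * T\<^sup>2 / real p)) * real (card V) ^ K
      \<le> real (card {\<beta> \<in> {1..K} \<rightarrow>\<^sub>E V. \<forall>j k. 1 \<le> j \<and> j < k \<and> k \<le> K \<longrightarrow> (\<beta> j, \<beta> k) \<notin> B})"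
    by (rule card_tuples_avoiding_pairs)
       (use * V card_bad_pairs[of p N T] in \<open>auto simp: B_def V_def\<close>)
  also have "{\<beta> \<in> {1..K} \<rightarrow>\<^sub>E V. \<forall>j k. 1 \<le> j \<and> j < k \<and> k \<le> K \<longrightarrow> (\<beta> j, \<beta> k) \<notin> B}
      = {\<beta> \<in> {1..K} \<rightarrow>\<^sub>E V. (MAX (j, k) \<in> P. \<bar>ndist p N (\<beta> j) (\<beta> k) - 1 / sqrt 2\<bar>) \<le> 1 / T}"
    using P by (intro Collect_cong conj_cong refl) (auto simp: B_def P_def PiE_iff not_less)
  finally show "1 / real (card (vertices p N)) ^ K *
        real (card {\<beta> \<in> {1..K} \<rightarrow>\<^sub>E vertices p N.
          (MAX (j, k) \<in> {(j, k). 1 \<le> j \<and> j < k \<and> k \<le> K}.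
             \<bar>ndist p N (\<beta> j) (\<beta> k) - 1 / sqrt 2\<bar>) \<le> 1 / T})
      \<ge> 1 - 10 * real K * (real K - 1) * T\<^sup>2 / real p"
    using V(3) unfolding V_def[symmetric] P_def[symmetric] by (simp add: field_simps)
qed simp_all

end
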